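(* Let $n\ge 1$, let $\Phi=\{f_1,\ldots,f_k\}$ be a finite subset of the free MV-algebra $\mathbf{F}_n$ and let $\beta:\Phi\to[0,1]$ be a book on $\Phi$. Then the following conditions are equivalent: (1) $\beta$ is strictly coherent; (2) $\beta$ extends to a faithful state of $\mathbf{F}_n$, i.e. there is a faithful state $s$ of $\mathbf{F}_n$ with $s(f)=\beta(f)$ for all $f\in\Phi$.
   Context: $\mathbf{F}_n$ is the free $n$-generated MV-algebra, identified with the algebra of all $n$-variable McNaughton functions: continuous functions $f:[0,1]^n\to[0,1]$ that are piecewise linear (affine) with finitely many pieces, each piece having integer coefficients. The operations are pointwise, with $x\oplus y=\min\{1,x+y\}$, $\neg x=1-x$, $x\odot y=\max\{0,x+y-1\}$ on $[0,1]$; $0$ and $1$ are the constant functions. Homomorphisms of $\mathbf{F}_n$ into the standard MV-algebra $[0,1]$ (valuations of Łukasiewicz logic) are exactly the evaluations $f\mapsto f(x)$ at points $x\in[0,1]^n$. A book on $\Phi=\{f_1,\ldots,f_k\}$ is a map $\beta:\Phi\to[0,1]$. It is strictly coherent if for all $\sigma_1,\ldots,\sigma_k\in\mathbb{R}$, the existence of $x\in[0,1]^n$ with $\sum_{i=1}^k\sigma_i(\beta(f_i)-f_i(x))<0$ implies the existence of $x'\in[0,1]^n$ with $\sum_{i=1}^k\sigma_i(\beta(f_i)-f_i(x'))>0$. A state of an MV-algebra $\mathbf{A}$ is a map $s:A\to[0,1]$ with $s(1)=1$ and $s(a\oplus b)=s(a)+s(b)$ whenever $a\odot b=0$. A state $s$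 is faithful if $s(a)\neq 0$ for all $a\neq 0$. *)

theory Defs
  imports "HOL-Analysis.Analysis"
begin

text \<open>MV-algebras in the signature (\<open>\<oplus>\<close>, \<open>\<not>\<close>, 0) on an explicit carrier; 1 and
  \<open>\<odot>\<close> are the usual derived operations.\<close>

record 'a mv_struct =
  mv_carrier :: "'a set"
  mv_oplus :: "'a \<Rightarrow> 'a \<Rightarrow> 'a"
  mv_neg :: "'a \<Rightarrow> 'a"
  mv_zero :: 'a

definition mv_one :: "('a, 'm) mv_struct_scheme \<Rightarrow> 'a" where
  "mv_one A = mv_neg A (mv_zero A)"

definition mv_odot :: "('a, 'm) mv_struct_scheme \<Rightarrow> 'a \<Rightarrow> 'a \<Rightarrow> 'a" where
  "mv_odot A a b = mv_neg A (mv_oplus A (mv_neg A a) (mv_neg A b))"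

locale mv_algebra =
  fixes A :: "('a, 'm) mv_struct_scheme"
  assumes zero_closed: "mv_zero A \<in> mv_carrier A"
    and neg_closed: "a \<in> mv_carrier A \<Longrightarrow> mv_neg A a \<in> mv_carrier A"
    and oplus_closed: "a \<in> mv_carrier A \<Longrightarrow> b \<in> mv_carrier A \<Longrightarrow> mv_oplus A a b \<in> mv_carrier A"
    and oplus_assoc: "a \<in> mv_carrier A \<Longrightarrow> b \<in> mv_carrier A \<Longrightarrow> c \<in> mv_carrier A \<Longrightarrow>
      mv_oplus A (mv_oplus A a b) c = mv_oplus A a (mv_oplus A b c)"
    and oplus_commute: "a \<in> mv_carrier A \<Longrightarrow> b \<in> mv_carrier A \<Longrightarrow>
      mv_oplus A a b = mv_oplus A b a"
    and oplus_zero: "a \<in> mv_carrier A \<Longrightarrow> mv_oplus A a (mv_zero A) = a"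
    and neg_neg: "a \<in> mv_carrier A \<Longrightarrow> mv_neg A (mv_neg A a) = a"
    and oplus_one: "a \<in> mv_carrier A \<Longrightarrow> mv_oplus A a (mv_neg A (mv_zero A)) = mv_neg A (mv_zero A)"
    and lukasiewicz: "a \<in> mv_carrier A \<Longrightarrow> b \<in> mv_carrier A \<Longrightarrow>
      mv_oplus A (mv_neg A (mv_oplus A (mv_neg A a) b)) b =
      mv_oplus A (mv_neg A (mv_oplus A (mv_neg A b) a)) a"

definition mv_state :: "('a, 'm) mv_struct_scheme \<Rightarrow> ('a \<Rightarrow> real) \<Rightarrow> bool" where
  "mv_state A s \<longleftrightarrow>
     s \<in> mv_carrier A \<rightarrow> {0..1} \<and>
     s (mv_one A) = 1 \<and>
     (\<forall>a\<in>mv_carrier A. \<forall>b\<in>mv_carrier A.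
        mv_odot A a b = mv_zero A \<longrightarrow> s (mv_oplus A a b) = s a + s b)"

definition faithful_mv_state :: "('a, 'm) mv_struct_scheme \<Rightarrow> ('a \<Rightarrow> real) \<Rightarrow> bool" where
  "faithful_mv_state A s \<longleftrightarrow>
     mv_state A s \<and> (\<forall>a\<in>mv_carrier A. a \<noteq> mv_zero A \<longrightarrow> s a \<noteq> 0)"

definition unit_cube :: "(real^'n) set" where
  "unit_cube = {x. \<forall>i. 0 \<le> x $ i \<and> x $ i \<le> 1}"

definition int_affine :: "('n::finite \<Rightarrow> int) \<Rightarrow> int \<Rightarrow> real^'n \<Rightarrow> real" where
  "int_affine a c x = (\<Sum>i\<in>UNIV. of_int (a i) * x $ i) + of_int c"

text \<open>McNaughton functions, as elements of the extensional function space
  \<open>unit_cube \<rightarrow>\<^sub>E {0..1}\<close>: the value off the cube is fixed, so that equality in the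
  algebra is equality of functions on the cube. Finiteness of the number of pieces is expressed
  as usual: finitely many affine functions with integer coefficients, one of which agrees with
  \<open>f\<close> at every given point.\<close>

definition mcnaughton :: "(real^'n \<Rightarrow> real) set" where
  "mcnaughton = {f \<in> unit_cube \<rightarrow>\<^sub>E {0..1}.
     continuous_on unit_cube f \<and>
     (\<exists>P. finite P \<and> (\<forall>x\<in>unit_cube. \<exists>(a, c)\<in>P. f x = int_affine a c x))}"

text \<open>The free \<open>n\<close>-generated MV-algebra for \<open>n = CARD('n)\<close>, in its representation by
  McNaughton functions.\<close>

definition free_mv :: "(real^'n \<Rightarrow> real) mv_struct" where
  "free_mv = \<lparr>
     mv_carrier = mcnaughton,
     mv_oplus = (\<lambda>f g. \<lambda>x\<in>unit_cube. min 1 (f x + g x)),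
     mv_neg = (\<lambda>f. \<lambda>x\<in>unit_cube. 1 - f x),
     mv_zero = (\<lambda>x\<in>unit_cube. 0)\<rparr>"

definition strictly_coherent ::
  "(real^'n \<Rightarrow> real) set \<Rightarrow> ((real^'n \<Rightarrow> real) \<Rightarrow> real) \<Rightarrow> bool" where
  "strictly_coherent \<Phi> \<beta> \<longleftrightarrow>
     (\<forall>\<sigma> :: (real^'n \<Rightarrow> real) \<Rightarrow> real.
        (\<exists>x\<in>unit_cube. (\<Sum>f\<in>\<Phi>. \<sigma> f * (\<beta> f - f x)) < 0) \<longrightarrow>
        (\<exists>x'\<in>unit_cube. (\<Sum>f\<in>\<Phi>. \<sigma> f * (\<beta> f - f x')) > 0))"

lemma free_mv_one: "mv_one free_mv = (\<lambda>x\<in>unit_cube. 1)"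
  by (auto simp: mv_one_def free_mv_def fun_eq_iff)

lemma free_mv_odot:
  "mv_odot free_mv f g = (\<lambda>x\<in>unit_cube. max 0 (f x + g x - 1))"
  by (auto simp: mv_odot_def free_mv_def fun_eq_iff min_def max_def)

lemma mcnaughton_range: "f \<in> mcnaughton \<Longrightarrow> x \<in> unit_cube \<Longrightarrow> 0 \<le> f x \<and> f x \<le> 1"
  by (fastforce simp: mcnaughton_def)

lemma mcnaughtonI:
  fixes h :: "real^'n \<Rightarrow> real"
  assumes "\<And>x. x \<in> unit_cube \<Longrightarrow> 0 \<le> h x \<and> h x \<le> 1"
    and "continuous_on unit_cube h"
    and "\<exists>P. finite P \<and> (\<forall>x\<in>unit_cube. \<exists>(a, c)\<in>P. h x = int_affine a c x)"
  shows "(\<lambda>x\<in>unit_cube. h x) \<in> mcnaughton"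
proof -
  have "continuous_on unit_cube (\<lambda>x\<in>unit_cube. h x)"
    by (rule continuous_on_eq[OF assms(2)]) simp
  moreover have "(\<lambda>x\<in>unit_cube. h x) \<in> unit_cube \<rightarrow>\<^sub>E {0..1}"
    using assms(1) by simp
  moreover obtain P where P: "finite P"
    "\<forall>x\<in>unit_cube. \<exists>(a, c)\<in>P. h x = int_affine a c x"
    using assms(3) by blast
  have "\<forall>x\<in>unit_cube. \<exists>(a, c)\<in>P. (\<lambda>x\<in>unit_cube. h x) x = int_affine a c x"
  proof
    fix x :: "real^'n" assume x: "x \<in> unit_cube"
    then show "\<exists>(a, c)\<in>P. (\<lambda>x\<in>unit_cube. h x) x = int_affine a c x"
      unfolding restrict_apply'[OF x] by (rule bspec[OF P(2)])
  qed
  ultimately show ?thesis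
    unfolding mcnaughton_def using P(1) by blast
qed

lemma mcnaughton_pieces:
  "f \<in> mcnaughton \<Longrightarrow>
   \<exists>P. finite P \<and> (\<forall>x\<in>unit_cube. \<exists>(a, c)\<in>P. f x = int_affine a c x)"
  unfolding mcnaughton_def by blast

lemma mcnaughton_continuous: "f \<in> mcnaughton \<Longrightarrow> continuous_on unit_cube f"
  unfolding mcnaughton_def by blast

lemma mcnaughton_proj:
  fixes i :: "'n::finite"
  shows "(\<lambda>x\<in>unit_cube. x $ i) \<in> mcnaughton"
proof (rule mcnaughtonI)
  have "x $ i = int_affine (\<lambda>j. if j = i then 1 else 0) 0 x" for x :: "real^'n"
  proof -
    have "(\<Sum>j\<in>UNIV. of_int (if j = i then 1 else 0) * x $ j) = (\<Sum>j\<in>UNIV. if j = i then x $ j else 0)"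
      by (rule sum.cong) auto
    then show ?thesis by (simp add: int_affine_def)
  qed
  then show "\<exists>P. finite P \<and> (\<forall>x\<in>unit_cube. \<exists>(a, c)\<in>P. (x::real^'n) $ i = int_affine a c x)"
    by (intro exI[of _ "{(\<lambda>j. if j = i then 1 else 0, 0)}"]) simp
qed (auto simp: unit_cube_def intro: continuous_intros)

lemma mcnaughton_zero: "(\<lambda>x\<in>unit_cube. 0) \<in> (mcnaughton :: (real^'n \<Rightarrow> real) set)"
proof (rule mcnaughtonI)
  show "\<exists>P. finite P \<and> (\<forall>x\<in>unit_cube. \<exists>(a, c)\<in>P. 0 = int_affine a c (x::real^'n))"
    by (rule exI[of _ "{(\<lambda>j. 0, 0)}"]) (simp add: int_affine_def)
qed simp_all

lemma mcnaughton_neg: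
  fixes f :: "real^'n \<Rightarrow> real"
  assumes f: "f \<in> mcnaughton"
  shows "(\<lambda>x\<in>unit_cube. 1 - f x) \<in> mcnaughton"
proof (rule mcnaughtonI)
  obtain P where P: "finite P" "\<forall>x\<in>unit_cube. \<exists>(a, c)\<in>P. f x = int_affine a c x"
    using mcnaughton_pieces[OF f] by blast
  let ?n = "\<lambda>(a, c). (\<lambda>i. - a i, 1 - c)"
  show "\<exists>P. finite P \<and> (\<forall>x\<in>unit_cube. \<exists>(a, c)\<in>P. 1 - f x = int_affine a c x)"
  proof (rule exI[of _ "?n ` P"], intro conjI ballI)
    show "finite (?n ` P)" using P by simp
  next
    fix x :: "real^'n" assume "x \<in> unit_cube"
    then obtain a c where ac: "(a, c) \<in> P" "f x = int_affine a c x" using P by blast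
    have "1 - f x = int_affine (\<lambda>i. - a i) (1 - c) x"
      by (simp add: ac int_affine_def sum_negf)
    then show "\<exists>(a, c)\<in>?n ` P. 1 - f x = int_affine a c x"
      using ac(1) by force
  qed
qed (use mcnaughton_range[OF f] mcnaughton_continuous[OF f] in \<open>auto intro!: continuous_intros\<close>)

lemma mcnaughton_oplus:
  fixes f g :: "real^'n \<Rightarrow> real"
  assumes f: "f \<in> mcnaughton" and g: "g \<in> mcnaughton"
  shows "(\<lambda>x\<in>unit_cube. min 1 (f x + g x)) \<in> mcnaughton"
proof (rule mcnaughtonI)
  obtain P where P: "finite P" "\<forall>x\<in>unit_cube. \<exists>(a, c)\<in>P. f x = int_affine a c x"
    using mcnaughton_pieces[OF f] by blast
  obtain Q where Q: "finite Q" "\<forall>x\<in>unit_cube. \<exists>(a, c)\<in>Q. g x = int_affine a c x"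
    using mcnaughton_pieces[OF g] by blast
  let ?s = "\<lambda>((a, c), (b, d)). (\<lambda>i. a i + b i, c + d)"
  let ?R = "insert (\<lambda>i. 0, 1) (?s ` (P \<times> Q))"
  show "\<exists>P. finite P \<and> (\<forall>x\<in>unit_cube. \<exists>(a, c)\<in>P. min 1 (f x + g x) = int_affine a c x)"
  proof (rule exI[of _ ?R], intro conjI ballI)
    show "finite ?R" using P Q by simp
  next
    fix x :: "real^'n" assume x: "x \<in> unit_cube"
    obtain a c where ac: "(a, c) \<in> P" "f x = int_affine a c x" using P x by blast
    obtain b d where bd: "(b, d) \<in> Q" "g x = int_affine b d x" using Q x by blast
    have mem: "(\<lambda>i. a i + b i, c + d) \<in> ?R" using ac(1) bd(1) by force
    have s: "f x + g x = int_affine (\<lambda>i. a i + b i) (c + d) x"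
      by (simp add: ac bd int_affine_def sum.distrib distrib_right)
    have o: "1 = int_affine (\<lambda>i. 0) 1 x" by (simp add: int_affine_def)
    show "\<exists>(a, c)\<in>?R. min 1 (f x + g x) = int_affine a c x"
    proof (cases "f x + g x \<le> 1")
      case True
      then show ?thesis using s by (intro bexI[OF _ mem]) simp
    next
      case False
      then show ?thesis using o by (intro bexI[of _ "(\<lambda>i. 0, 1)"]) auto
    qed
  qed
qed (use mcnaughton_range[OF f] mcnaughton_range[OF g] mcnaughton_continuous[OF f]
      mcnaughton_continuous[OF g] in \<open>auto intro!: continuous_intros\<close>)

lemma mv_algebra_free_mv: "mv_algebra (free_mv :: (real^'n \<Rightarrow> real) mv_struct)"
proof -
  have ext: "(\<lambda>x\<in>unit_cube. h x) = f" if "f \<in> mcnaughton" "\<And>x. x \<in> unit_cube \<Longrightarrow> h x = f x"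
    for f h :: "real^'n \<Rightarrow> real"
    using that by (force simp: mcnaughton_def PiE_def extensional_def fun_eq_iff)
  have r: "0 \<le> f x" "f x \<le> 1" if "f \<in> mcnaughton" "x \<in> unit_cube" for f and x :: "real^'n"
    using mcnaughton_range[OF that] by auto
  show ?thesis
  proof (unfold_locales, simp_all only: free_mv_def mv_struct.simps)
    fix f g h :: "real^'n \<Rightarrow> real"
    assume f: "f \<in> mcnaughton" and g: "g \<in> mcnaughton" and h: "h \<in> mcnaughton"
    show "(\<lambda>x\<in>unit_cube. min 1 ((\<lambda>x\<in>unit_cube. min 1 (f x + g x)) x + h x)) =
      (\<lambda>x\<in>unit_cube. min 1 (f x + (\<lambda>x\<in>unit_cube. min 1 (g x + h x)) x))"
    proof (rule restrict_ext)
      fix x :: "real^'n" assume x: "x \<in> unit_cube"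
      show "min 1 ((\<lambda>x\<in>unit_cube. min 1 (f x + g x)) x + h x) =
        min 1 (f x + (\<lambda>x\<in>unit_cube. min 1 (g x + h x)) x)"
        using r[OF f x] r[OF g x] r[OF h x] x by (auto simp: min_def)
    qed
  next
    fix f g :: "real^'n \<Rightarrow> real"
    assume f: "f \<in> mcnaughton" and g: "g \<in> mcnaughton"
    show "(\<lambda>x\<in>unit_cube. min 1 ((\<lambda>x\<in>unit_cube. 1 - (\<lambda>x\<in>unit_cube.
          min 1 ((\<lambda>x\<in>unit_cube. 1 - f x) x + g x)) x) x + g x)) =
      (\<lambda>x\<in>unit_cube. min 1 ((\<lambda>x\<in>unit_cube. 1 - (\<lambda>x\<in>unit_cube.
          min 1 ((\<lambda>x\<in>unit_cube. 1 - g x) x + f x)) x) x + f x))"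
    proof (rule restrict_ext)
      fix x :: "real^'n" assume x: "x \<in> unit_cube"
      show "min 1 ((\<lambda>x\<in>unit_cube. 1 - (\<lambda>x\<in>unit_cube.
          min 1 ((\<lambda>x\<in>unit_cube. 1 - f x) x + g x)) x) x + g x) =
        min 1 ((\<lambda>x\<in>unit_cube. 1 - (\<lambda>x\<in>unit_cube.
          min 1 ((\<lambda>x\<in>unit_cube. 1 - g x) x + f x)) x) x + f x)"
        using r[OF f x] r[OF g x] x by (auto simp: min_def)
    qed
  next
    fix f :: "real^'n \<Rightarrow> real"
    assume f: "f \<in> mcnaughton"
    show "(\<lambda>x\<in>unit_cube. min 1 (f x + (\<lambda>x\<in>unit_cube. 0) x)) = f"
      by (rule ext[OF f]) (use r[OF f] in \<open>auto simp: min_def intro: antisym\<close>)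
    show "(\<lambda>x\<in>unit_cube. 1 - (\<lambda>x\<in>unit_cube. 1 - f x) x) = f"
      by (rule ext[OF f]) simp
    show "(\<lambda>x\<in>unit_cube. min 1 (f x + (\<lambda>x\<in>unit_cube. 1 - (\<lambda>x\<in>unit_cube. 0) x) x)) =
      (\<lambda>x\<in>unit_cube. 1 - (\<lambda>x\<in>unit_cube. 0) x)"
      by (rule restrict_ext) (use r[OF f] in \<open>auto simp: min_def\<close>)
  qed (simp_all add: mcnaughton_zero mcnaughton_neg mcnaughton_oplus add.commute)
qed

end

theory Submission
  imports Defs
begin

text \<open>
  Let \<open>V\<close> be the span of \<open>\<Phi>\<close> and the constants, and \<open>L\<close> the linear functional on \<open>V\<close> with
  \<open>L 1 = 1\<close> and \<open>L f = \<beta> f\<close>. Strict coherence says that \<open>L v > 0\<close> for every nonzero \<open>v \<ge> 0\<close>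
  in \<open>V\<close>. As \<open>V\<close> is finite-dimensional, compactness yields \<open>\<theta> \<in> (0, 1)\<close> such that
  \<open>L v \<ge> \<theta> v(y)\<close> for all \<open>v \<ge> 0\<close> and all points \<open>y\<close>, hence \<open>L v \<ge> \<theta> \<integral> v\<close>. So
  \<open>(L - \<theta> \<integral>) / (1 - \<theta>)\<close> is still positive, it extends to a state by a Hahn-Banach argument, and
  mixing the integral back in makes that state faithful while restoring \<open>\<beta>\<close> on \<open>\<Phi>\<close>.

  Conversely, Riesz decomposition shows that a state is positive on real combinations of McNaughton
  functions. If \<open>0 \<le> v \<in> V\<close> and \<open>v \<noteq> 0\<close>, then \<open>v\<close> lies above a positive multiple of a
  nonzero McNaughton spike, on which a faithful state is positive; therefore \<open>L v > 0\<close>.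
\<close>

section \<open>A quantitative form of strict coherence\<close>

text \<open>Coordinates outside \<open>I\<close> are pinned to 0, so this is a closed subset of a
  product of compact intervals. It plays the unit sphere of the sup norm on coefficient
  vectors.\<close>

lemma compact_sign_sphere:
  assumes "finite I"
  shows "compact {\<sigma> :: 'i \<Rightarrow> real. (\<forall>i. \<sigma> i \<in> (if i \<in> I then {-1..1} else {0})) \<and> (\<exists>i\<in>I. \<bar>\<sigma> i\<bar> = 1)}"
proof -
  let ?B = "\<lambda>i. if i \<in> I then {-1..1} else {0 :: real}"
  have "compactin (product_topology (\<lambda>i. euclidean) UNIV) (PiE UNIV ?B)"
    by (simp add: compactin_PiE)
  then have "compact (PiE UNIV ?B)"
    by (simp add: euclidean_product_topology)
  moreover have "closed (\<Union>i\<in>I. {\<sigma> :: 'i \<Rightarrow> real. \<bar>\<sigma> i\<bar> = 1})"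
    using assms by (intro closed_UN ballI closed_Collect_eq continuous_intros) auto
  ultimately have "compact (PiE UNIV ?B \<inter> (\<Union>i\<in>I. {\<sigma>. \<bar>\<sigma> i\<bar> = 1}))"
    by blast
  then show ?thesis
    by (rule back_subst) (auto simp: PiE_def Pi_def)
qed

text \<open>The coefficient vectors of sup norm 1 form a compact set, covered by the open sets of those
  whose combination is below \<open>- 1 / (n + 1)\<close> at some given point of \<open>X\<close>.\<close>

lemma strict_uniform_bound_independent:
  fixes u :: "'i \<Rightarrow> 'a \<Rightarrow> real"
  assumes fin: "finite I"
    and bd: "\<And>i x. i \<in> I \<Longrightarrow> x \<in> X \<Longrightarrow> \<bar>u i x\<bar> \<le> 1"
    and neg: "\<And>\<sigma>. \<exists>i\<in>I. \<sigma> i \<noteq> 0 \<Longrightarrow> \<exists>x\<in>X. (\<Sum>i\<in>I. \<sigma> i * u i x) < 0"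
  shows "\<exists>\<theta>>0. \<forall>\<sigma> c. (\<forall>x\<in>X. 0 \<le> c + (\<Sum>i\<in>I. \<sigma> i * u i x)) \<longrightarrow>
           (\<forall>y\<in>X. \<theta> * (\<Sum>i\<in>I. \<sigma> i * u i y) \<le> c)"
proof -
  let ?v = "\<lambda>\<sigma> x. \<Sum>i\<in>I. \<sigma> i * u i x"
  define S where "S = {\<sigma> :: 'i \<Rightarrow> real.
    (\<forall>i. \<sigma> i \<in> (if i \<in> I then {-1..1} else {0})) \<and> (\<exists>i\<in>I. \<bar>\<sigma> i\<bar> = 1)}"
  define U where "U = (\<lambda>(x, n :: nat). {\<sigma>. ?v \<sigma> x < - (1 / real (Suc n))})"
  have "compact S"
    unfolding S_def using fin by (rule compact_sign_sphere)
  moreover have "open (U p)" for p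
    unfolding U_def by (cases p) (auto intro!: open_Collect_less continuous_intros)
  moreover have "S \<subseteq> (\<Union>p\<in>X \<times> UNIV. U p)"
  proof
    fix \<sigma> assume "\<sigma> \<in> S"
    then have "\<exists>i\<in>I. \<sigma> i \<noteq> 0"
      by (force simp: S_def)
    then obtain x where x: "x \<in> X" "?v \<sigma> x < 0"
      using neg by blast
    then obtain n where "inverse (real (Suc n)) < - ?v \<sigma> x"
      using reals_Archimedean[of "- ?v \<sigma> x"] by auto
    then have "\<sigma> \<in> U (x, n)"
      by (simp add: U_def inverse_eq_divide)
    with x show "\<sigma> \<in> (\<Union>p\<in>X \<times> UNIV. U p)"
      by blast
  qed
  ultimately obtain C where C: "C \<subseteq> X \<times> UNIV" "finite C" "S \<subseteq> (\<Union>p\<in>C. U p)"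
    by (rule compactE_image)
  \<comment> \<open>The largest index in the finite subcover gives the smallest margin, which then
    serves all of \<open>S\<close>.\<close>
  obtain N where N: "\<forall>n\<in>snd ` C. n \<le> N"
    using C(2) finite_nat_set_iff_bounded_le by blast
  define \<delta> where "\<delta> = 1 / real (Suc N)"
  have \<delta>: "\<delta> > 0"
    by (simp add: \<delta>_def)
  have uni: "\<exists>x\<in>X. ?v \<sigma> x < - \<delta>" if \<sigma>: "\<sigma> \<in> S" for \<sigma>
  proof -
    obtain p where "p \<in> C" "\<sigma> \<in> U p"
      using C(3) \<sigma> by blast
    then obtain x n where xn: "(x, n) \<in> C" "?v \<sigma> x < - (1 / real (Suc n))"
      by (cases p) (auto simp: U_def)
    then have "n \<le> N"
      using N by force
    then have "\<delta> \<le> 1 / real (Suc n)"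
      by (simp add: \<delta>_def frac_le)
    with xn C(1) show ?thesis
      by force
  qed
  \<comment> \<open>For a vector of sup norm \<open>r\<close>, the combination is at most
    \<open>card I * r\<close> on \<open>X\<close>, while the hypothesis on \<open>c\<close> forces
    \<open>c\<close> to be at least \<open>\<delta> * r\<close>; the constant is the quotient of the
    two bounds. \<open>Suc\<close> keeps the denominator nonzero for empty \<open>I\<close>.\<close>
  show ?thesis
  proof (intro exI[of _ "\<delta> / real (Suc (card I))"] conjI allI impI ballI)
    show "0 < \<delta> / real (Suc (card I))"
      using \<delta> by simp
    fix \<sigma> c y
    assume pos: "\<forall>x\<in>X. 0 \<le> c + ?v \<sigma> x" and y: "y \<in> X"
    show "\<delta> / real (Suc (card I)) * ?v \<sigma> y \<le> c"
    proof (cases "\<forall>i\<in>I. \<sigma> i = 0")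
      case True
      then show ?thesis
        using pos y by force
    next
      case False
      define r where "r = Max ((\<lambda>i. \<bar>\<sigma> i\<bar>) ` I)"
      have le: "\<bar>\<sigma> i\<bar> \<le> r" if "i \<in> I" for i
        unfolding r_def using fin that by simp
      have r: "r > 0"
        using False le by force
      have "r \<in> (\<lambda>i. \<bar>\<sigma> i\<bar>) ` I"
        unfolding r_def using fin False by (intro Max_in) auto
      then obtain j where j: "j \<in> I" "\<bar>\<sigma> j\<bar> = r"
        by blast
      \<comment> \<open>\<open>S\<close> asks for sup norm 1 and zeros off \<open>I\<close>. The
        point where the combination for \<open>\<tau>\<close> drops below \<open>- \<delta>\<close>
        bounds \<open>c\<close> after scaling back by \<open>r\<close>.\<close>
      define \<tau> where "\<tau> = (\<lambda>i. if i \<in> I then \<sigma> i / r else 0)"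
      have "\<tau> i \<in> (if i \<in> I then {-1..1} else {0})" for i
        using le[of i] r by (auto simp: \<tau>_def field_simps abs_le_iff)
      moreover have "\<bar>\<tau> j\<bar> = 1"
        using j r by (simp add: \<tau>_def)
      ultimately have "\<tau> \<in> S"
        using j(1) unfolding S_def by blast
      then obtain x where x: "x \<in> X" "?v \<tau> x < - \<delta>"
        using uni by blast
      have "?v \<tau> x = ?v \<sigma> x / r"
        unfolding sum_divide_distrib by (rule sum.cong) (auto simp: \<tau>_def)
      then have "?v \<sigma> x < - \<delta> * r"
        using x(2) r by (simp add: divide_less_eq)
      then have c: "\<delta> * r \<le> c"
        using pos x(1) by force
      have "?v \<sigma> y \<le> (\<Sum>i\<in>I. r)"
      proof (rule sum_mono)
        fix i assume i: "i \<in> I"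
        have "\<sigma> i * u i y \<le> \<bar>\<sigma> i\<bar> * \<bar>u i y\<bar>"
          by (metis abs_ge_self abs_mult)
        also have "\<dots> \<le> r * 1"
          using le[OF i] bd[OF i y] r by (intro mult_mono) auto
        finally show "\<sigma> i * u i y \<le> r"
          by simp
      qed
      then have "?v \<sigma> y \<le> real (Suc (card I)) * r"
        using r by (simp add: distrib_right)
      then have "\<delta> / real (Suc (card I)) * ?v \<sigma> y \<le> \<delta> / real (Suc (card I)) * (real (Suc (card I)) * r)"
        using \<delta> by (intro mult_left_mono) auto
      also have "\<dots> = \<delta> * r"
        by simp
      finally show ?thesis
        using c by simp
    qed
  qed
qed

text \<open>In the presence of a linear relation, one of the functions is dropped; otherwise the previous
  lemma applies.\<close>

lemma strict_uniform_bound: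
  fixes u :: "'i \<Rightarrow> 'a \<Rightarrow> real"
  assumes "finite I"
    and "\<And>i x. i \<in> I \<Longrightarrow> x \<in> X \<Longrightarrow> \<bar>u i x\<bar> \<le> 1"
    and "\<And>\<sigma>. \<exists>x\<in>X. (\<Sum>i\<in>I. \<sigma> i * u i x) > 0 \<Longrightarrow> \<exists>x\<in>X. (\<Sum>i\<in>I. \<sigma> i * u i x) < 0"
  shows "\<exists>\<theta>>0. \<forall>\<sigma> c. (\<forall>x\<in>X. 0 \<le> c + (\<Sum>i\<in>I. \<sigma> i * u i x)) \<longrightarrow>
           (\<forall>y\<in>X. \<theta> * (\<Sum>i\<in>I. \<sigma> i * u i y) \<le> c)"
  using assms
proof (induction I rule: finite_psubset_induct)
  case (psubset I)
  show ?case
  proof (cases "\<exists>\<rho>. (\<exists>i\<in>I. \<rho> i \<noteq> 0) \<and> (\<forall>x\<in>X. (\<Sum>i\<in>I. \<rho> i * u i x) = 0)")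
    case True
    then obtain \<rho> j where \<rho>: "\<forall>x\<in>X. (\<Sum>i\<in>I. \<rho> i * u i x) = 0" and j: "j \<in> I" "\<rho> j \<noteq> 0"
      by blast
    let ?J = "I - {j}"
    \<comment> \<open>Extending coefficients by 0 at \<open>j\<close> transfers the hypothesis on
      \<open>I\<close> to the smaller index set.\<close>
    have zero_j: "(\<Sum>i\<in>I. (if i = j then 0 else \<sigma> i) * u i x) = (\<Sum>i\<in>?J. \<sigma> i * u i x)" for \<sigma> :: "'i \<Rightarrow> real" and x
      using psubset.hyps j(1) by (intro sum.mono_neutral_cong_right) auto
    have "\<exists>\<theta>>0. \<forall>\<sigma> c. (\<forall>x\<in>X. 0 \<le> c + (\<Sum>i\<in>?J. \<sigma> i * u i x)) \<longrightarrow>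
            (\<forall>y\<in>X. \<theta> * (\<Sum>i\<in>?J. \<sigma> i * u i y) \<le> c)"
    proof (rule psubset.IH)
      fix \<sigma> assume "\<exists>x\<in>X. (\<Sum>i\<in>?J. \<sigma> i * u i x) > 0"
      then show "\<exists>x\<in>X. (\<Sum>i\<in>?J. \<sigma> i * u i x) < 0"
        using psubset.prems(2)[of "\<lambda>i. if i = j then 0 else \<sigma> i"] unfolding zero_j by blast
    qed (use j psubset.prems in auto)
    then obtain \<theta> where \<theta>: "\<theta> > 0" and bound:
      "\<And>\<sigma> c y. \<forall>x\<in>X. 0 \<le> c + (\<Sum>i\<in>?J. \<sigma> i * u i x) \<Longrightarrow> y \<in> X \<Longrightarrow>
         \<theta> * (\<Sum>i\<in>?J. \<sigma> i * u i y) \<le> c"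
      by blast
    show ?thesis
    proof (intro exI[of _ \<theta>] conjI allI impI ballI \<theta>)
      fix \<sigma> c y
      assume pos: "\<forall>x\<in>X. 0 \<le> c + (\<Sum>i\<in>I. \<sigma> i * u i x)" and y: "y \<in> X"
      \<comment> \<open>This multiple of the vanishing relation cancels the coefficient at
        \<open>j\<close> without changing any value on \<open>X\<close>.\<close>
      let ?\<tau> = "\<lambda>i. \<sigma> i - \<sigma> j / \<rho> j * \<rho> i"
      have eq: "(\<Sum>i\<in>?J. ?\<tau> i * u i x) = (\<Sum>i\<in>I. \<sigma> i * u i x)" if "x \<in> X" for x
      proof -
        have "(\<Sum>i\<in>?J. ?\<tau> i * u i x) = (\<Sum>i\<in>I. ?\<tau> i * u i x)"
          using psubset.hyps j by (intro sum.mono_neutral_left) auto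
        also have "\<dots> = (\<Sum>i\<in>I. \<sigma> i * u i x) - \<sigma> j / \<rho> j * (\<Sum>i\<in>I. \<rho> i * u i x)"
          by (simp add: left_diff_distrib sum_subtractf sum_distrib_left mult.assoc)
        finally show ?thesis
          using \<rho> that by simp
      qed
      have "\<forall>x\<in>X. 0 \<le> c + (\<Sum>i\<in>?J. ?\<tau> i * u i x)"
      proof
        fix x assume x: "x \<in> X"
        show "0 \<le> c + (\<Sum>i\<in>?J. ?\<tau> i * u i x)"
          unfolding eq[OF x] using pos x by blast
      qed
      from bound[OF this y] show "\<theta> * (\<Sum>i\<in>I. \<sigma> i * u i y) \<le> c"
        unfolding eq[OF y] .
    qed
  next
    case False
    \<comment> \<open>Without a relation, a nonzero vector yields a function with a nonzero value on
      \<open>X\<close>; if that value is positive, the sign hypothesis supplies a negative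
      one.\<close>
    show ?thesis
    proof (rule strict_uniform_bound_independent[OF psubset.hyps psubset.prems(1)])
      fix \<sigma> :: "'i \<Rightarrow> real" assume "\<exists>i\<in>I. \<sigma> i \<noteq> 0"
      then obtain x where "x \<in> X" "(\<Sum>i\<in>I. \<sigma> i * u i x) \<noteq> 0"
        using False by blast
      then show "\<exists>x\<in>X. (\<Sum>i\<in>I. \<sigma> i * u i x) < 0"
        using psubset.prems(2)[of \<sigma>] by (cases "(\<Sum>i\<in>I. \<sigma> i * u i x) > 0") force+
    qed
  qed
qed

section \<open>Extension of coherent books\<close>

text \<open>A pair \<open>(f, t)\<close> is a function together with its price; the set below is the linear span of
  \<open>M\<close> and \<open>(1, 1)\<close>, for \<open>M\<close> not necessarily single-valued.\<close>

inductive_set affine_pairs :: "(('a \<Rightarrow> real) \<times> real) set \<Rightarrow> (('a \<Rightarrow> real) \<times> real) set"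
  for M where
  const: "((\<lambda>x. c), c) \<in> affine_pairs M"
| step: "(w, r) \<in> affine_pairs M \<Longrightarrow> (f, t) \<in> M \<Longrightarrow>
    ((\<lambda>x. w x + k * f x), r + k * t) \<in> affine_pairs M"

text \<open>Positivity of the price on the whole span. It makes the price monotone, so functions
  that agree on \<open>X\<close> get the same price although \<open>M\<close> is only a
  relation.\<close>

definition coherent_on :: "'a set \<Rightarrow> (('a \<Rightarrow> real) \<times> real) set \<Rightarrow> bool" where
  "coherent_on X M \<longleftrightarrow> (\<forall>(w, r)\<in>affine_pairs M. (\<forall>x\<in>X. 0 \<le> w x) \<longrightarrow> 0 \<le> r)"

lemma coherent_onD:
  "coherent_on X M \<Longrightarrow> (w, r) \<in> affine_pairs M \<Longrightarrow> (\<And>x. x \<in> X \<Longrightarrow> 0 \<le> w x) \<Longrightarrow> 0 \<le> r"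
  unfolding coherent_on_def by blast

lemma affine_pairs_base: "(f, t) \<in> M \<Longrightarrow> (f, t) \<in> affine_pairs M"
  using affine_pairs.step[OF affine_pairs.const[of 0 M], of f t 1] by simp

text \<open>The rule \<open>step\<close> adds one generator at a time, so closure under linear
  combinations is an induction on the second summand; a constant summand is carried through an inner
  induction on the first.\<close>

lemma affine_pairs_lincomb:
  assumes w: "(w, r) \<in> affine_pairs M" and v: "(v, q) \<in> affine_pairs M"
  shows "((\<lambda>x. w x + k * v x), r + k * q) \<in> affine_pairs M"
  using v
proof induction
  case (const c)
  show ?case
    using w
  proof induction
    case (const d)
    show ?case
      by (rule affine_pairs.const)
  next
    case (step w r f t l)
    then show ?case
      using affine_pairs.step[of "\<lambda>x. w x + k * c" "r + k * c" M f t l] by (simp add: ac_simps)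
  qed
next
  case (step v q f t l)
  then show ?case
    using affine_pairs.step[of "\<lambda>x. w x + k * v x" "r + k * q" M f t "k * l"]
    by (simp add: algebra_simps)
qed

lemma affine_pairs_mono:
  assumes "M \<subseteq> N"
  shows "affine_pairs M \<subseteq> affine_pairs N"
proof
  fix p assume "p \<in> affine_pairs M"
  then have "(fst p, snd p) \<in> affine_pairs M"
    by simp
  then have "(fst p, snd p) \<in> affine_pairs N"
    by induction (use assms in \<open>auto intro: affine_pairs.intros\<close>)
  then show "p \<in> affine_pairs N"
    by simp
qed

lemma affine_pairs_insert:
  assumes "(w, r) \<in> affine_pairs (insert (g, t) M)"
  shows "\<exists>w' r' k. (w', r') \<in> affine_pairs M \<and> w = (\<lambda>x. w' x + k * g x) \<and> r = r' + k * t"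
  using assms
proof induction
  case (const c)
  have "((\<lambda>x. c), c) \<in> affine_pairs M"
    by (rule affine_pairs.const)
  then show ?case
    by (intro exI[of _ "\<lambda>x. c"] exI[of _ c] exI[of _ 0]) simp
next
  case (step w r f s l)
  then obtain w' r' k where IH: "(w', r') \<in> affine_pairs M"
    "w = (\<lambda>x. w' x + k * g x)" "r = r' + k * t"
    by blast
  show ?case
  proof (cases "(f, s) = (g, t)")
    case True
    then show ?thesis
      using IH by (intro exI[of _ w'] exI[of _ r'] exI[of _ "k + l"]) (auto simp: algebra_simps)
  next
    case False
    then have "((\<lambda>x. w' x + l * f x), r' + l * s) \<in> affine_pairs M"
      using step.hyps IH(1) by (auto intro: affine_pairs.step)
    then show ?thesis
      using IH(2,3) by (intro exI conjI) (auto simp: algebra_simps)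
  qed
qed

section \<open>Hahn-Banach extension of positive prices\<close>

lemma coherent_on_mono:
  assumes M: "coherent_on X M" and w: "(w, r) \<in> affine_pairs M" and v: "(v, q) \<in> affine_pairs M"
    and le: "\<And>x. x \<in> X \<Longrightarrow> w x \<le> v x"
  shows "r \<le> q"
  using coherent_onD[OF M affine_pairs_lincomb[OF v w, of "-1"]] le by simp

text \<open>An element of the span uses finitely many generators, and these already lie in a single
  member of the chain.\<close>

lemma coherent_on_Union_chain:
  assumes ne: "C \<noteq> {}" and chain: "subset.chain \<A> C" and coh: "\<And>M. M \<in> C \<Longrightarrow> coherent_on X M"
  shows "coherent_on X (\<Union>C)"
proof -
  have "\<exists>M\<in>C. (w, r) \<in> affine_pairs M" if "(w, r) \<in> affine_pairs (\<Union>C)" for w r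
    using that
  proof induction
    case (const c)
    then show ?case
      using ne by (auto intro: affine_pairs.const)
  next
    case (step w r f t k)
    then obtain M N where MN: "M \<in> C" "(w, r) \<in> affine_pairs M" "N \<in> C" "(f, t) \<in> N"
      by blast
    then have "M \<subseteq> N \<or> N \<subseteq> M"
      using chain by (auto simp: subset_chain_def)
    then show ?case
      using MN affine_pairs_mono[of M N] by (auto intro: affine_pairs.step)
  qed
  then show ?thesis
    using coh unfolding coherent_on_def by blast
qed

text \<open>The one-dimensional Hahn-Banach step: a price for \<open>g\<close> must separate the
  prices of span elements below \<open>g\<close> from those above it, and the supremum of the lower
  prices does so. The constants \<open>- B\<close> and \<open>B\<close> keep this supremum
  finite.\<close>

lemma coherent_on_insert:
  assumes M: "coherent_on X M" and X: "X \<noteq> {}" and g: "\<And>x. x \<in> X \<Longrightarrow> \<bar>g x\<bar> \<le> B"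
  shows "\<exists>t. coherent_on X (insert (g, t) M)"
proof -
  define L where "L = {r. \<exists>w. (w, r) \<in> affine_pairs M \<and> (\<forall>x\<in>X. w x \<le> g x)}"
  have upper: "r \<le> q" if r: "r \<in> L" and v: "(v, q) \<in> affine_pairs M" and le: "\<And>x. x \<in> X \<Longrightarrow> g x \<le> v x" for r v q
  proof -
    obtain w where w: "(w, r) \<in> affine_pairs M" "\<forall>x\<in>X. w x \<le> g x"
      using r unfolding L_def by blast
    then show ?thesis
      using le by (intro coherent_on_mono[OF M w(1) v]) (blast intro: order_trans)
  qed
  have B: "- B \<le> g x" "g x \<le> B" if "x \<in> X" for x
    using g[OF that] by (simp_all add: abs_le_iff)
  have "- B \<in> L"
    unfolding L_def using B(1) affine_pairs.const[of "- B" M] by blast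
  then have ne: "L \<noteq> {}"
    by blast
  have bdd: "bdd_above L"
    by (rule bdd_aboveI[of _ B]) (rule upper[OF _ affine_pairs.const[of B M] B(2)])
  have "coherent_on X (insert (g, Sup L) M)"
    unfolding coherent_on_def
  proof clarify
    fix w r assume wr: "(w, r) \<in> affine_pairs (insert (g, Sup L) M)" and pos: "\<forall>x\<in>X. 0 \<le> w x"
    obtain v q k where v: "(v, q) \<in> affine_pairs M" and w: "w = (\<lambda>x. v x + k * g x)"
      and r: "r = q + k * Sup L"
      using affine_pairs_insert[OF wr] by blast
    \<comment> \<open>Nonnegativity of \<open>v + k * g\<close> compares \<open>g\<close> with
      \<open>- v / k\<close>: from below if \<open>k\<close> is positive, from above if
      \<open>k\<close> is negative.\<close>
    have scaled: "((\<lambda>x. - (v x / k)), - (q / k)) \<in> affine_pairs M"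
      using affine_pairs_lincomb[OF affine_pairs.const[of 0 M] v, of "- 1 / k"] by simp
    consider "k = 0" | "k > 0" | "k < 0"
      by linarith
    then show "0 \<le> r"
    proof cases
      case 1
      then show ?thesis
        using coherent_onD[OF M v] pos w r by simp
    next
      case 2
      have "- (v x / k) \<le> g x" if "x \<in> X" for x
        using pos that 2 by (auto simp: w field_simps)
      then have "- (q / k) \<in> L"
        unfolding L_def using scaled by blast
      then have "- (q / k) \<le> Sup L"
        by (rule cSup_upper[OF _ bdd])
      then show ?thesis
        using 2 by (simp add: r field_simps)
    next
      case 3
      have "g x \<le> - (v x / k)" if "x \<in> X" for x
        using pos that 3 by (auto simp: w field_simps)
      then have "Sup L \<le> - (q / k)"
        using upper[OF _ scaled] by (intro cSup_least[OF ne]) auto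
      then show ?thesis
        using 3 by (simp add: r field_simps)
    qed
  qed
  then show ?thesis ..
qed

text \<open>A set that is maximal by Zorn's lemma prices every function bounded on \<open>X\<close>,
  since otherwise the one-dimensional step would enlarge it.\<close>

lemma coherent_on_extend:
  assumes M: "coherent_on X M" and X: "X \<noteq> {}"
  obtains N where "M \<subseteq> N" "coherent_on X N"
    "\<And>g B. (\<And>x. x \<in> X \<Longrightarrow> \<bar>g x\<bar> \<le> B) \<Longrightarrow> \<exists>t. (g, t) \<in> N"
proof -
  let ?\<A> = "{N. M \<subseteq> N \<and> coherent_on X N}"
  have "\<exists>N\<in>?\<A>. \<forall>N'\<in>?\<A>. N \<subseteq> N' \<longrightarrow> N' = N"
  proof (rule subset_Zorn_nonempty)
    show "?\<A> \<noteq> {}"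
      using M by blast
    fix C assume C: "C \<noteq> {}" "subset.chain ?\<A> C"
    then have "C \<subseteq> ?\<A>"
      by (simp add: subset_chain_def)
    then show "\<Union>C \<in> ?\<A>"
      using C(1) coherent_on_Union_chain[OF C] by blast
  qed
  then obtain N where "N \<in> ?\<A>" and max: "\<forall>N'\<in>?\<A>. N \<subseteq> N' \<longrightarrow> N' = N"
    by (rule bexE)
  then have N: "M \<subseteq> N" "coherent_on X N"
    by simp_all
  have "\<exists>t. (g, t) \<in> N" if g: "\<And>x. x \<in> X \<Longrightarrow> \<bar>g x\<bar> \<le> B" for g B
  proof -
    obtain t where "coherent_on X (insert (g, t) N)"
      using coherent_on_insert[OF N(2) X, of g B] g by blast
    then have "insert (g, t) N = N"
      using N(1) max by (simp add: subset_insertI subset_insertI2)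
    then have "(g, t) \<in> N"
      by blast
    then show ?thesis ..
  qed
  with N show thesis
    by (rule that)
qed

text \<open>Collecting coefficients brings span elements over a finite book into the form of the
  sums in the definition of strict coherence.\<close>

lemma affine_pairs_graph:
  assumes "(w, r) \<in> affine_pairs ((\<lambda>f. (f, b f)) ` A)" and "finite A"
  shows "\<exists>\<sigma> c. w = (\<lambda>x. c + (\<Sum>f\<in>A. \<sigma> f * f x)) \<and> r = c + (\<Sum>f\<in>A. \<sigma> f * b f)"
  using assms(1)
proof induction
  case (const c)
  show ?case
    by (intro exI[of _ "\<lambda>f. 0"] exI[of _ c]) simp
next
  case (step w r f t k)
  then obtain \<sigma> c where IH: "w = (\<lambda>x. c + (\<Sum>f\<in>A. \<sigma> f * f x))" "r = c + (\<Sum>f\<in>A. \<sigma> f * b f)"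
    by blast
  have f: "f \<in> A" "t = b f"
    using step.hyps by auto
  have upd: "(\<Sum>h\<in>A. (\<sigma> h + (if h = f then k else 0)) * F h) = (\<Sum>h\<in>A. \<sigma> h * F h) + k * F f" for F
  proof -
    have "(\<Sum>h\<in>A. (if h = f then k else 0) * F h) = (\<Sum>h\<in>A. if h = f then k * F h else 0)"
      by (rule sum.cong) auto
    then show ?thesis
      using f(1) assms(2) by (simp add: distrib_right sum.distrib)
  qed
  show ?case
    by (intro exI[of _ "\<lambda>h. \<sigma> h + (if h = f then k else 0)"] exI[of _ c])
      (simp add: IH f upd add.assoc)
qed

section \<open>States are positive\<close>

lemma mcnaughton_one: "(\<lambda>x\<in>unit_cube. 1) \<in> (mcnaughton :: (real^'n \<Rightarrow> real) set)"
proof -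
  have "(\<lambda>x\<in>unit_cube. 1 - (\<lambda>x\<in>unit_cube. 0) x) = (\<lambda>x\<in>(unit_cube :: (real^'n) set). 1 :: real)"
    by (rule restrict_ext) simp
  then show ?thesis
    using mcnaughton_neg[OF mcnaughton_zero] by metis
qed

lemma mcnaughton_eqI:
  "f \<in> mcnaughton \<Longrightarrow> g \<in> mcnaughton \<Longrightarrow> (\<And>x. x \<in> unit_cube \<Longrightarrow> f x = g x) \<Longrightarrow> f = g"
  unfolding mcnaughton_def by (auto intro: PiE_ext)

text \<open>Truncated difference is the MV term \<not>(\<not>f \<oplus> g).\<close>

lemma mcnaughton_minus:
  fixes f g :: "real^'n \<Rightarrow> real"
  assumes f: "f \<in> mcnaughton" and g: "g \<in> mcnaughton"
  shows "(\<lambda>x\<in>unit_cube. max 0 (f x - g x)) \<in> mcnaughton"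
proof -
  have "(\<lambda>x\<in>unit_cube. 1 - (\<lambda>x\<in>unit_cube. min 1 ((\<lambda>x\<in>unit_cube. 1 - f x) x + g x)) x) \<in> mcnaughton"
    by (intro mcnaughton_neg mcnaughton_oplus f g)
  also have "(\<lambda>x\<in>unit_cube. 1 - (\<lambda>x\<in>unit_cube. min 1 ((\<lambda>x\<in>unit_cube. 1 - f x) x + g x)) x) =
    (\<lambda>x\<in>unit_cube. max 0 (f x - g x))"
    by (rule restrict_ext) auto
  finally show ?thesis .
qed

text \<open>The minimum is the truncated difference of \<open>f\<close> and the truncated difference
  of \<open>f\<close> and \<open>g\<close>.\<close>

lemma mcnaughton_min:
  fixes f g :: "real^'n \<Rightarrow> real"
  assumes f: "f \<in> mcnaughton" and g: "g \<in> mcnaughton"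
  shows "(\<lambda>x\<in>unit_cube. min (f x) (g x)) \<in> mcnaughton"
proof -
  have "(\<lambda>x\<in>unit_cube. max 0 (f x - (\<lambda>x\<in>unit_cube. max 0 (f x - g x)) x)) \<in> mcnaughton"
    by (intro mcnaughton_minus f g)
  also have "(\<lambda>x\<in>unit_cube. max 0 (f x - (\<lambda>x\<in>unit_cube. max 0 (f x - g x)) x)) =
    (\<lambda>x\<in>unit_cube. min (f x) (g x))"
  proof (rule restrict_ext)
    fix x :: "real^'n" assume x: "x \<in> unit_cube"
    show "max 0 (f x - (\<lambda>x\<in>unit_cube. max 0 (f x - g x)) x) = min (f x) (g x)"
      using mcnaughton_range[OF f x] mcnaughton_range[OF g x] x by (auto simp: min_def max_def)
  qed
  finally show ?thesis .
qed

section \<open>Additivity and monotonicity of states\<close>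

lemma mv_carrier_free_mv [simp]: "mv_carrier free_mv = mcnaughton"
  and mv_zero_free_mv: "mv_zero free_mv = (\<lambda>x\<in>unit_cube. 0)"
  and mv_oplus_free_mv: "mv_oplus free_mv f g = (\<lambda>x\<in>unit_cube. min 1 (f x + g x))"
  by (simp_all add: free_mv_def)

lemma free_mv_odot_eq_zero_iff:
  "mv_odot free_mv f g = mv_zero free_mv \<longleftrightarrow> (\<forall>x\<in>unit_cube. f x + g x \<le> 1)"
  unfolding free_mv_odot mv_zero_free_mv
  by (auto simp: fun_eq_iff restrict_def max_def) (smt (verit))+

lemma mv_state_range: "mv_state free_mv s \<Longrightarrow> f \<in> mcnaughton \<Longrightarrow> 0 \<le> s f \<and> s f \<le> 1"
  unfolding mv_state_def by (auto simp: Pi_def)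

text \<open>As \<open>c\<close> takes values at most 1, the sum is never truncated, so
  \<open>a\<close> and \<open>b\<close> are orthogonal and \<open>c\<close> is their MV sum.\<close>

lemma mv_state_add:
  fixes a b c :: "real^'n \<Rightarrow> real"
  assumes s: "mv_state free_mv s" and mem: "a \<in> mcnaughton" "b \<in> mcnaughton" "c \<in> mcnaughton"
    and eq: "\<And>x. x \<in> unit_cube \<Longrightarrow> c x = a x + b x"
  shows "s c = s a + s b"
proof -
  have le: "a x + b x \<le> 1" if "x \<in> unit_cube" for x
    using mcnaughton_range[OF mem(3) that] eq[OF that] by simp
  have "mv_oplus free_mv a b \<in> mcnaughton"
    unfolding mv_oplus_free_mv using mem by (intro mcnaughton_oplus)
  then have "mv_oplus free_mv a b = c"
    using mem(3) le eq by (intro mcnaughton_eqI) (auto simp: mv_oplus_free_mv)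
  moreover have "mv_odot free_mv a b = mv_zero free_mv"
    using le by (simp add: free_mv_odot_eq_zero_iff)
  ultimately show ?thesis
    using s mem by (auto simp: mv_state_def)
qed

lemma mv_state_diff:
  fixes a b :: "real^'n \<Rightarrow> real"
  assumes s: "mv_state free_mv s" and mem: "a \<in> mcnaughton" "b \<in> mcnaughton"
    and le: "\<And>x. x \<in> unit_cube \<Longrightarrow> b x \<le> a x"
  shows "s (\<lambda>x\<in>unit_cube. max 0 (a x - b x)) = s a - s b"
  using mv_state_add[OF s mem(2) mcnaughton_minus[OF mem] mem(1)] le by simp

text \<open>Riesz decomposition: \<open>f\<close> is split off the functions \<open>v j\<close> one after the other.\<close>

lemma mv_state_split:
  fixes f :: "real^'n \<Rightarrow> real"
  assumes s: "mv_state free_mv s" and "finite J" and "f \<in> mcnaughton"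
    and "\<And>j. j \<in> J \<Longrightarrow> v j \<in> mcnaughton"
    and "\<And>x. x \<in> unit_cube \<Longrightarrow> f x \<le> (\<Sum>j\<in>J. v j x)"
  shows "\<exists>w. (\<forall>j\<in>J. w j \<in> mcnaughton) \<and> (\<forall>x\<in>unit_cube. (\<Sum>j\<in>J. w j x) = (\<Sum>j\<in>J. v j x) - f x) \<and>
    (\<Sum>j\<in>J. s (w j)) = (\<Sum>j\<in>J. s (v j)) - s f"
  using assms(2-5)
proof (induction J arbitrary: f rule: finite_induct)
  case empty
  then have "f x = 0" if "x \<in> unit_cube" for x
    using mcnaughton_range[of f x] that by force
  moreover from this have "s f = s f + s f"
    using mv_state_add[OF s empty(1,1,1)] by simp
  ultimately show ?case
    by auto
next
  case (insert j J)
  note f = \<open>f \<in> mcnaughton\<close>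
  have vj: "v j \<in> mcnaughton"
    using insert.prems by simp
  \<comment> \<open>\<open>h\<close> is the share of \<open>f\<close> taken out of
    \<open>v j\<close>. Where \<open>f\<close> exceeds \<open>v j\<close>, the remainder is
    \<open>f - v j\<close> and lies below the other summands; elsewhere it is 0.\<close>
  define h where "h = (\<lambda>x\<in>unit_cube. min (f x) (v j x))"
  have h: "h \<in> mcnaughton" and hle: "\<And>x. x \<in> unit_cube \<Longrightarrow> h x \<le> f x" "\<And>x. x \<in> unit_cube \<Longrightarrow> h x \<le> v j x"
    unfolding h_def using f vj by (auto intro: mcnaughton_min)
  define f' where "f' = (\<lambda>x\<in>unit_cube. max 0 (f x - h x))"
  have f': "f' \<in> mcnaughton"
    unfolding f'_def using f h by (rule mcnaughton_minus)
  have f'_eq: "f' x = f x - h x" if "x \<in> unit_cube" for x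
    using that hle by (simp add: f'_def)
  have "f' x \<le> (\<Sum>i\<in>J. v i x)" if x: "x \<in> unit_cube" for x
  proof -
    have "0 \<le> (\<Sum>i\<in>J. v i x)"
      using mcnaughton_range x insert.prems(2) by (intro sum_nonneg) blast
    then show ?thesis
      using insert.prems(3)[OF x] insert.hyps x by (auto simp: f'_eq h_def min_def)
  qed
  then obtain w where w: "\<forall>i\<in>J. w i \<in> mcnaughton"
    "\<forall>x\<in>unit_cube. (\<Sum>i\<in>J. w i x) = (\<Sum>i\<in>J. v i x) - f' x"
    "(\<Sum>i\<in>J. s (w i)) = (\<Sum>i\<in>J. s (v i)) - s f'"
    using insert.IH[OF f'] insert.prems(2) by auto
  define z where "z = (\<lambda>x\<in>unit_cube. max 0 (v j x - h x))"
  have z: "z \<in> mcnaughton"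
    unfolding z_def using vj h by (rule mcnaughton_minus)
  have "s f' = s f - s h"
    unfolding f'_def by (rule mv_state_diff[OF s f h hle(1)])
  moreover have "s z = s (v j) - s h"
    unfolding z_def by (rule mv_state_diff[OF s vj h hle(2)])
  moreover have "(\<Sum>i\<in>insert j J. F ((w(j := z)) i)) = F z + (\<Sum>i\<in>J. F (w i))" for F :: "_ \<Rightarrow> real"
  proof -
    have "(\<Sum>i\<in>J. F ((w(j := z)) i)) = (\<Sum>i\<in>J. F (w i))"
      using insert.hyps by (intro sum.cong) auto
    then show ?thesis
      using insert.hyps by simp
  qed
  note sums = this[of s] this[of "\<lambda>u. u x" for x]
  have "z x = v j x - h x" if "x \<in> unit_cube" for x
    using that hle by (simp add: z_def)
  ultimately show ?case
    using w z insert.hyps by (intro exI[of _ "w(j := z)"]) (auto simp: sums f'_eq simp del: fun_upd_apply, auto)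
qed

text \<open>The sums may exceed 1 and leave the algebra, so \<open>s\<close> cannot be applied to
  them. Instead each \<open>u i\<close> is split off the family \<open>v\<close>, which leaves a
  family with the same index set for the induction.\<close>

lemma mv_state_sum_mono:
  fixes u :: "'i \<Rightarrow> real^'n \<Rightarrow> real"
  assumes s: "mv_state free_mv s" and "finite I" and J: "finite J"
    and "\<And>i. i \<in> I \<Longrightarrow> u i \<in> mcnaughton" and "\<And>j. j \<in> J \<Longrightarrow> v j \<in> mcnaughton"
    and "\<And>x. x \<in> unit_cube \<Longrightarrow> (\<Sum>i\<in>I. u i x) \<le> (\<Sum>j\<in>J. v j x)"
  shows "(\<Sum>i\<in>I. s (u i)) \<le> (\<Sum>j\<in>J. s (v j))"
  using assms(2,4-6)
proof (induction I arbitrary: v rule: finite_induct)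
  case empty
  then show ?case
    using mv_state_range[OF s] by (auto intro: sum_nonneg)
next
  case (insert i I)
  have nonneg: "0 \<le> (\<Sum>i\<in>I. u i x)" if "x \<in> unit_cube" for x
    using insert.prems(1) mcnaughton_range that by (intro sum_nonneg) blast
  have "\<exists>w. (\<forall>j\<in>J. w j \<in> mcnaughton) \<and>
    (\<forall>x\<in>unit_cube. (\<Sum>j\<in>J. w j x) = (\<Sum>j\<in>J. v j x) - u i x) \<and>
    (\<Sum>j\<in>J. s (w j)) = (\<Sum>j\<in>J. s (v j)) - s (u i)"
  proof (rule mv_state_split[OF s J])
    fix x :: "real^'n" assume x: "x \<in> unit_cube"
    show "u i x \<le> (\<Sum>j\<in>J. v j x)"
      using insert.prems(3)[OF x] nonneg[OF x] insert.hyps by simp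
  qed (use insert.prems in auto)
  then obtain w where w: "\<And>j. j \<in> J \<Longrightarrow> w j \<in> mcnaughton"
    "\<And>x. x \<in> unit_cube \<Longrightarrow> (\<Sum>j\<in>J. w j x) = (\<Sum>j\<in>J. v j x) - u i x"
    "(\<Sum>j\<in>J. s (w j)) = (\<Sum>j\<in>J. s (v j)) - s (u i)"
    by blast
  have "(\<Sum>i\<in>I. s (u i)) \<le> (\<Sum>j\<in>J. s (w j))"
    using insert.prems insert.hyps w by (intro insert.IH) (force simp: algebra_simps)+
  then show ?case
    using insert.hyps w(3) by simp
qed

lemma mv_state_int_combination_nonneg:
  fixes u :: "'i \<Rightarrow> real^'n \<Rightarrow> real" and k :: "'i \<Rightarrow> int"
  assumes s: "mv_state free_mv s" and fin: "finite I" and u: "\<And>i. i \<in> I \<Longrightarrow> u i \<in> mcnaughton"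
    and pos: "\<And>x. x \<in> unit_cube \<Longrightarrow> 0 \<le> (\<Sum>i\<in>I. of_int (k i) * u i x)"
  shows "0 \<le> (\<Sum>i\<in>I. of_int (k i) * s (u i))"
proof -
  \<comment> \<open>Negative terms move to the other side, and each function is repeated as often as
    its coefficient says; \<open>nat\<close> turns coefficients of the wrong sign into no
    copies.\<close>
  let ?N = "Sigma I (\<lambda>i. {..<nat (- k i)})" and ?P = "Sigma I (\<lambda>i. {..<nat (k i)})"
  have "(\<Sum>p\<in>Sigma I (\<lambda>i. {..<m i}). F (fst p)) = (\<Sum>i\<in>I. real (m i) * F i)"
    for m :: "'i \<Rightarrow> nat" and F :: "'i \<Rightarrow> real"
    using sum.Sigma[OF fin, of "\<lambda>i. {..<m i}" "\<lambda>i _. F i"] by (simp add: split_def)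
  note N = this[of _ "\<lambda>i. nat (- k i)"] and P = this[of _ "\<lambda>i. nat (k i)"]
  have split: "(\<Sum>i\<in>I. of_int (k i) * F i) =
    (\<Sum>i\<in>I. real (nat (k i)) * F i) - (\<Sum>i\<in>I. real (nat (- k i)) * F i)" for F :: "'i \<Rightarrow> real"
  proof -
    have "of_int (k i) = real (nat (k i)) - real (nat (- k i))" for i
      by (cases "k i \<ge> 0") auto
    then show ?thesis
      by (simp add: left_diff_distrib sum_subtractf)
  qed
  have "(\<Sum>p\<in>?N. s (u (fst p))) \<le> (\<Sum>p\<in>?P. s (u (fst p)))"
  proof (rule mv_state_sum_mono[OF s])
    fix x :: "real^'n" assume x: "x \<in> unit_cube"
    show "(\<Sum>p\<in>?N. u (fst p) x) \<le> (\<Sum>p\<in>?P. u (fst p) x)"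
      using pos[OF x] N[of "\<lambda>i. u i x"] P[of "\<lambda>i. u i x"] split[of "\<lambda>i. u i x"] by simp
  qed (use fin u in auto)
  then show ?thesis
    using N[of "\<lambda>i. s (u i)"] P[of "\<lambda>i. s (u i)"] split[of "\<lambda>i. s (u i)"] by simp
qed

text \<open>Coefficients are scaled by \<open>N\<close> and rounded up, which keeps the combination
  nonnegative because the functions are. Rounding adds at most 1 per term to the value under
  \<open>s\<close>, too little to offset a negative value multiplied by a large
  \<open>N\<close>.\<close>

lemma mv_state_combination_nonneg:
  fixes u :: "'i \<Rightarrow> real^'n \<Rightarrow> real" and k :: "'i \<Rightarrow> real"
  assumes s: "mv_state free_mv s" and fin: "finite I" and u: "\<And>i. i \<in> I \<Longrightarrow> u i \<in> mcnaughton"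
    and pos: "\<And>x. x \<in> unit_cube \<Longrightarrow> 0 \<le> (\<Sum>i\<in>I. k i * u i x)"
  shows "0 \<le> (\<Sum>i\<in>I. k i * s (u i))"
proof (rule ccontr)
  let ?S = "\<Sum>i\<in>I. k i * s (u i)"
  assume "\<not> 0 \<le> ?S"
  then obtain N :: nat where N: "real (card I) < real N * - ?S"
    using reals_Archimedean3[of "- ?S"] by auto
  have "0 \<le> (\<Sum>i\<in>I. of_int \<lceil>real N * k i\<rceil> * s (u i))"
  proof (rule mv_state_int_combination_nonneg[OF s fin u])
    fix x :: "real^'n" assume x: "x \<in> unit_cube"
    have "0 \<le> real N * (\<Sum>i\<in>I. k i * u i x)"
      using pos[OF x] by simp
    also have "\<dots> = (\<Sum>i\<in>I. real N * k i * u i x)"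
      by (simp add: sum_distrib_left mult.assoc)
    also have "\<dots> \<le> (\<Sum>i\<in>I. of_int \<lceil>real N * k i\<rceil> * u i x)"
      using mcnaughton_range[OF u x] by (intro sum_mono mult_right_mono) auto
    finally show "0 \<le> (\<Sum>i\<in>I. of_int \<lceil>real N * k i\<rceil> * u i x)" .
  qed
  also have "\<dots> \<le> (\<Sum>i\<in>I. real N * (k i * s (u i)) + 1)"
  proof (rule sum_mono)
    fix i assume "i \<in> I"
    then have r: "0 \<le> s (u i)" "s (u i) \<le> 1"
      using mv_state_range[OF s u] by auto
    have "of_int \<lceil>real N * k i\<rceil> * s (u i) \<le> (real N * k i + 1) * s (u i)"
      using r of_int_ceiling_le_add_one by (intro mult_right_mono) auto
    then show "of_int \<lceil>real N * k i\<rceil> * s (u i) \<le> real N * (k i * s (u i)) + 1"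
      using r by (simp add: algebra_simps)
  qed
  also have "\<dots> = real N * ?S + real (card I)"
    by (simp add: sum.distrib sum_distrib_left)
  finally show False
    using N by simp
qed

section \<open>Spikes\<close>

text \<open>The linear pieces are indexed by the sign patterns of the \<open>N x\<^sub>i - k\<^sub>i\<close>.\<close>

lemma mcnaughton_spike:
  fixes k :: "'n::finite \<Rightarrow> int" and N :: int
  shows "(\<lambda>x\<in>unit_cube. max 0 (1 - (\<Sum>i\<in>UNIV. \<bar>of_int N * x $ i - of_int (k i)\<bar>)))
    \<in> (mcnaughton :: (real^'n \<Rightarrow> real) set)"
proof (rule mcnaughtonI)
  let ?h = "\<lambda>x :: real^'n. max 0 (1 - (\<Sum>i\<in>UNIV. \<bar>of_int N * x $ i - of_int (k i)\<bar>))"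
  let ?piece = "\<lambda>\<epsilon> :: 'n \<Rightarrow> bool. let e = (\<lambda>i. if \<epsilon> i then 1 else - 1 :: int) in
    ((\<lambda>i. - e i * N), 1 + (\<Sum>i\<in>UNIV. e i * k i))"
  let ?P = "insert (\<lambda>i. 0, 0) (range ?piece)"
  show "\<exists>P. finite P \<and> (\<forall>x\<in>unit_cube. \<exists>(a, c)\<in>P. ?h x = int_affine a c x)"
  proof (intro exI[of _ ?P] conjI ballI)
    show "finite ?P"
      by simp
    fix x :: "real^'n"
    show "\<exists>(a, c)\<in>?P. ?h x = int_affine a c x"
    proof (cases "?h x = 0")
      case True
      then show ?thesis
        by (intro bexI[of _ "(\<lambda>i. 0, 0)"]) (auto simp: int_affine_def)
    next
      case False
      define \<epsilon> where "\<epsilon> = (\<lambda>i. of_int N * x $ i - of_int (k i) \<ge> 0)"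
      define e where "e = (\<lambda>i. if \<epsilon> i then 1 else - 1 :: int)"
      have "(\<Sum>i\<in>UNIV. \<bar>of_int N * x $ i - of_int (k i)\<bar>) =
        (\<Sum>i\<in>UNIV. of_int (e i) * (of_int N * x $ i - of_int (k i)))"
        by (rule sum.cong) (auto simp: e_def \<epsilon>_def)
      then have "?h x = int_affine (\<lambda>i. - e i * N) (1 + (\<Sum>i\<in>UNIV. e i * k i)) x"
        using False by (simp add: int_affine_def right_diff_distrib sum_subtractf sum_negf mult.assoc)
      moreover have "?piece \<epsilon> = ((\<lambda>i. - e i * N), 1 + (\<Sum>i\<in>UNIV. e i * k i))"
        by (simp add: e_def Let_def)
      ultimately show ?thesis
        by (intro bexI[OF _ insertI2[OF rangeI[of ?piece \<epsilon>]]]) simp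
    qed
  qed
  show "0 \<le> ?h x \<and> ?h x \<le> 1" if "x \<in> unit_cube" for x
    by (simp add: sum_nonneg)
qed (intro continuous_intros)

text \<open>By continuity \<open>g\<close> stays above \<open>g x0 / 2\<close> near
  \<open>x0\<close>. A spike of height 1 with its peak at a nearby grid point and its support in
  that neighbourhood, scaled by \<open>g x0 / 2\<close>, lies below \<open>g\<close>.\<close>

lemma mcnaughton_below_continuous:
  fixes g :: "real^'n \<Rightarrow> real"
  assumes cont: "continuous_on unit_cube g" and nonneg: "\<And>x. x \<in> unit_cube \<Longrightarrow> 0 \<le> g x"
    and x0: "x0 \<in> unit_cube" "0 < g x0"
  obtains h \<delta> where "h \<in> mcnaughton" "h \<noteq> (\<lambda>x\<in>unit_cube. 0)" "\<delta> > 0"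
    "\<And>x. x \<in> unit_cube \<Longrightarrow> \<delta> * h x \<le> g x"
proof -
  obtain d where d: "d > 0" "\<And>x. x \<in> unit_cube \<Longrightarrow> dist x x0 < d \<Longrightarrow> dist (g x) (g x0) < g x0 / 2"
    using cont x0 unfolding continuous_on_iff by (meson half_gt_zero)
  \<comment> \<open>In each coordinate, rounding \<open>x0\<close> to the grid and moving within the
    support of the spike cost at most \<open>1 / N\<close> each, so the total distance is at most
    2n/N for dimension n.\<close>
  obtain N :: nat where N: "2 * real CARD('n) < real N * d"
    using reals_Archimedean3[OF d(1)] by blast
  then have N0: "N > 0"
    using d(1) by (cases N) auto
  \<comment> \<open>Rounding down keeps the peak \<open>q\<close> inside the cube, so the spike is
    nonzero there.\<close>
  define k where "k = (\<lambda>i. \<lfloor>real N * x0 $ i\<rfloor>)"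
  define q :: "real^'n" where "q = (\<chi> i. of_int (k i) / real N)"
  define h where "h = (\<lambda>x\<in>unit_cube. max 0 (1 - (\<Sum>i\<in>UNIV. \<bar>of_int (int N) * (x :: real^'n) $ i - of_int (k i)\<bar>)))"
  have q: "q \<in> unit_cube"
  proof -
    have "0 \<le> k i \<and> of_int (k i) \<le> real N" for i
    proof -
      have "0 \<le> x0 $ i" "x0 $ i \<le> 1"
        using x0(1) by (auto simp: unit_cube_def)
      then have "0 \<le> real N * x0 $ i" "real N * x0 $ i \<le> real N"
        by (auto simp: mult_left_le)
      then show ?thesis
        unfolding k_def by (auto intro: order_trans[OF of_int_floor_le])
    qed
    then show ?thesis
      using N0 by (auto simp: unit_cube_def q_def)
  qed
  have "h q = 1"
    using q N0 by (simp add: h_def) (simp add: q_def)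
  then have "h \<noteq> (\<lambda>x\<in>unit_cube. 0)"
    using q by auto
  moreover have "h \<in> mcnaughton"
    unfolding h_def by (rule mcnaughton_spike)
  moreover have "g x0 / 2 * h x \<le> g x" if x: "x \<in> unit_cube" for x
  proof (cases "h x = 0")
    case True
    then show ?thesis
      using nonneg[OF x] by simp
  next
    case False
    then have lt: "(\<Sum>i\<in>UNIV. \<bar>real N * x $ i - of_int (k i)\<bar>) < 1"
      using x by (auto simp: h_def max_def split: if_splits)
    have "\<bar>(x - x0) $ i\<bar> \<le> 2 / real N" for i
    proof -
      have "\<bar>real N * x $ i - of_int (k i)\<bar> \<le> (\<Sum>i\<in>UNIV. \<bar>real N * x $ i - of_int (k i)\<bar>)"
        by (rule member_le_sum) auto
      moreover have "\<bar>real N * x0 $ i - of_int (k i)\<bar> \<le> 1"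
        unfolding k_def by linarith
      ultimately have "\<bar>real N * x $ i - real N * x0 $ i\<bar> \<le> 2"
        using lt by linarith
      then have "real N * \<bar>(x - x0) $ i\<bar> \<le> 2"
        by (simp flip: right_diff_distrib add: abs_mult)
      then show ?thesis
        using N0 by (simp add: field_simps)
    qed
    then have "norm (x - x0) \<le> (\<Sum>i\<in>(UNIV :: 'n set). 2 / real N)"
      by (intro order_trans[OF norm_le_l1_cart] sum_mono)
    also have "\<dots> < d"
      using N N0 by (simp add: field_simps)
    finally have "dist (g x) (g x0) < g x0 / 2"
      using d(2)[OF x] by (simp add: dist_norm)
    then have "g x0 / 2 \<le> g x"
      unfolding dist_real_def by linarith
    moreover have "h x \<le> 1"
      using mcnaughton_range[OF \<open>h \<in> mcnaughton\<close> x] by simp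
    ultimately show ?thesis
      using x0(2) mult_left_le[of "h x" "g x0 / 2"] by linarith
  qed
  ultimately show thesis
    using that[of h "g x0 / 2"] x0(2) by simp
qed

section \<open>The Lebesgue state\<close>

lemma unit_cube_eq_cbox: "(unit_cube :: (real^'n) set) = cbox 0 1"
  by (auto simp: unit_cube_def mem_box_cart)

lemma content_unit_cube: "measure lborel (unit_cube :: (real^'n) set) = 1"
proof -
  have "(cbox 0 1 :: (real^'n) set) \<noteq> {}"
    by (simp add: interval_ne_empty_cart)
  then show ?thesis
    by (simp add: unit_cube_eq_cbox content_cbox_cart)
qed

lemma zero_in_unit_cube: "0 \<in> unit_cube"
  by (simp add: unit_cube_def)

lemma integrable_unit_cube:
  "continuous_on unit_cube f \<Longrightarrow> (f :: real^'n \<Rightarrow> real) integrable_on unit_cube"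
  unfolding unit_cube_eq_cbox by (rule integrable_continuous)

lemma integral_unit_cube_const: "integral (unit_cube :: (real^'n) set) (\<lambda>x. c :: real) = c"
  using content_unit_cube[where 'n = 'n] by (simp add: unit_cube_eq_cbox)

lemma integral_mcnaughton_nonneg: "f \<in> mcnaughton \<Longrightarrow> 0 \<le> integral unit_cube f"
  by (intro integral_nonneg integrable_unit_cube mcnaughton_continuous)
    (auto dest: mcnaughton_range)

lemma integral_mcnaughton_le_one:
  fixes f :: "real^'n \<Rightarrow> real"
  assumes "f \<in> mcnaughton"
  shows "integral unit_cube f \<le> 1"
proof -
  have "integral unit_cube f \<le> integral (unit_cube :: (real^'n) set) (\<lambda>x. 1)"
    using assms mcnaughton_range
    by (intro integral_le integrable_unit_cube mcnaughton_continuous continuous_on_const) auto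
  then show ?thesis
    by (simp add: integral_unit_cube_const)
qed

text \<open>A continuous nonnegative function with integral 0 over a box with nonempty interior
  vanishes on it. This is the faithfulness of the Lebesgue state.\<close>

lemma integral_mcnaughton_pos:
  fixes f :: "real^'n \<Rightarrow> real"
  assumes f: "f \<in> mcnaughton" and ne: "f \<noteq> (\<lambda>x\<in>unit_cube. 0)"
  shows "0 < integral unit_cube f"
proof -
  obtain x where x: "x \<in> unit_cube" "f x \<noteq> 0"
    using mcnaughton_eqI[OF f mcnaughton_zero] ne by auto
  have "integral unit_cube f \<noteq> 0"
  proof
    assume "integral unit_cube f = 0"
    then have "(f has_integral 0) (cbox 0 1)"
      using integrable_unit_cube[OF mcnaughton_continuous[OF f]]
      by (metis integrable_integral unit_cube_eq_cbox)
    moreover have "0 \<le> f y" if "y \<in> box 0 1" for y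
      using mcnaughton_range[OF f] that box_subset_cbox unfolding unit_cube_eq_cbox by blast
    moreover have "box 0 1 \<noteq> ({} :: (real^'n) set)"
      by (simp add: interval_ne_empty_cart)
    ultimately have "f x = 0"
      using has_integral_0_cbox_imp_0[of 0 1 f x] mcnaughton_continuous[OF f] x(1)
      unfolding unit_cube_eq_cbox by blast
    with x show False
      by simp
  qed
  with integral_mcnaughton_nonneg[OF f] show ?thesis
    by simp
qed

lemma integral_unit_cube_combination:
  fixes \<sigma> :: "(real^'n \<Rightarrow> real) \<Rightarrow> real"
  assumes "finite A" "A \<subseteq> mcnaughton"
  shows "integral unit_cube (\<lambda>x. c + (\<Sum>f\<in>A. \<sigma> f * f x)) = c + (\<Sum>f\<in>A. \<sigma> f * integral unit_cube f)"
proof -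
  have int: "f integrable_on unit_cube" if "f \<in> A" for f
    using that assms(2) by (auto intro: integrable_unit_cube mcnaughton_continuous)
  then have "integral unit_cube (\<lambda>x. \<Sum>f\<in>A. \<sigma> f * f x) = (\<Sum>f\<in>A. \<sigma> f * integral unit_cube f)"
    using assms(1) by (subst integral_sum) (auto intro: integrable_on_mult_right)
  moreover have "(\<lambda>x. \<Sum>f\<in>A. \<sigma> f * f x) integrable_on unit_cube"
    using int assms(1) by (intro integrable_sum) (auto intro: integrable_on_mult_right)
  moreover have "(\<lambda>x. c) integrable_on (unit_cube :: (real^'n) set)"
    by (intro integrable_unit_cube continuous_intros)
  ultimately show ?thesis
    by (simp add: integral_add integral_unit_cube_const)
qed

section \<open>Strict coherence and faithful states\<close>

text \<open>A failure of strict coherence makes \<open>?g\<close> nonnegative and somewhere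
  positive, hence above a multiple \<open>\<delta> * h\<close> of a spike. The linear extension of
  \<open>s\<close> gives \<open>?g\<close> the value 0 but the spike a positive one, against
  positivity.\<close>

lemma strictly_coherent_of_faithful:
  fixes \<Phi> :: "(real^'n \<Rightarrow> real) set"
  assumes fin: "finite \<Phi>" and mc: "\<Phi> \<subseteq> mcnaughton"
    and s: "faithful_mv_state free_mv s" and ext: "\<And>f. f \<in> \<Phi> \<Longrightarrow> s f = \<beta> f"
  shows "strictly_coherent \<Phi> \<beta>"
  unfolding strictly_coherent_def
proof (intro allI impI, rule ccontr)
  fix \<sigma>
  let ?g = "\<lambda>x. \<Sum>f\<in>\<Phi>. \<sigma> f * (f x - \<beta> f)"
  have st: "mv_state free_mv s"
    using s by (simp add: faithful_mv_state_def)
  have neg: "(\<Sum>f\<in>\<Phi>. \<sigma> f * (\<beta> f - f x)) = - ?g x" for x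
    by (simp flip: sum_negf add: algebra_simps)
  assume "\<exists>x\<in>unit_cube. (\<Sum>f\<in>\<Phi>. \<sigma> f * (\<beta> f - f x)) < 0"
  then obtain x0 where x0: "x0 \<in> unit_cube" "0 < ?g x0"
    by (auto simp: neg)
  assume "\<not> (\<exists>x\<in>unit_cube. (\<Sum>f\<in>\<Phi>. \<sigma> f * (\<beta> f - f x)) > 0)"
  then have nonneg: "0 \<le> ?g x" if "x \<in> unit_cube" for x
    using that by (force simp: neg)
  have cont: "continuous_on unit_cube ?g"
    using mc by (intro continuous_intros) (auto intro: mcnaughton_continuous)
  obtain h \<delta> where h: "h \<in> mcnaughton" "h \<noteq> (\<lambda>x\<in>unit_cube. 0)" "\<delta> > 0"
    "\<And>x. x \<in> unit_cube \<Longrightarrow> \<delta> * h x \<le> ?g x"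
    using mcnaughton_below_continuous[OF cont nonneg x0] by blast
  define b where "b = (\<Sum>f\<in>\<Phi>. \<sigma> f * \<beta> f)"
  \<comment> \<open>The combination \<open>?g - \<delta> * h\<close> as one indexed family:
    \<open>True\<close> stands for the constant 1, \<open>False\<close> for \<open>h\<close>. The
    sum type keeps these indices apart from \<open>\<Phi>\<close> even if the functions belong to
    it.\<close>
  let ?I = "\<Phi> <+> {True, False}"
  let ?u = "case_sum (\<lambda>f. f) (\<lambda>c. if c then \<lambda>x\<in>unit_cube. 1 else h)"
  let ?k = "case_sum \<sigma> (\<lambda>c. if c then - b else - \<delta>)"
  have sum: "(\<Sum>i\<in>?I. ?k i * F (?u i)) = (\<Sum>f\<in>\<Phi>. \<sigma> f * F f) - b * F (\<lambda>x\<in>unit_cube. 1) - \<delta> * F h" for F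
    using fin by (simp add: sum.Plus)
  have "0 \<le> (\<Sum>i\<in>?I. ?k i * s (?u i))"
  proof (rule mv_state_combination_nonneg[OF st])
    show "?u i \<in> mcnaughton" if "i \<in> ?I" for i
      using that mc h(1) by (auto simp: mcnaughton_one)
    fix x :: "real^'n" assume x: "x \<in> unit_cube"
    show "0 \<le> (\<Sum>i\<in>?I. ?k i * ?u i x)"
      using h(4)[OF x] x sum[of "\<lambda>f. f x"] by (simp add: b_def right_diff_distrib sum_subtractf)
  qed (use fin in simp)
  moreover have "s (\<lambda>x\<in>unit_cube. 1) = 1"
    using st by (simp add: mv_state_def free_mv_one)
  ultimately have "\<delta> * s h \<le> 0"
    unfolding sum by (simp add: ext b_def)
  moreover have "s h > 0"
    using mv_state_range[OF st h(1)] s h(1,2)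
    by (force simp: faithful_mv_state_def mv_zero_free_mv)
  ultimately show False
    using h(3) mult_pos_pos[of \<delta> "s h"] by linarith
qed

text \<open>A total coherent pricing restricted to McNaughton functions is a state: monotonicity
  against constants gives the range, and the MV sum of orthogonal elements is their pointwise
  sum.\<close>

lemma coherent_extends_to_state:
  fixes \<Phi> :: "(real^'n \<Rightarrow> real) set"
  assumes coh: "coherent_on unit_cube ((\<lambda>f. (f, b f)) ` \<Phi>)"
  shows "\<exists>s. mv_state free_mv s \<and> (\<forall>f\<in>\<Phi>. s f = b f)"
proof -
  obtain N where N: "(\<lambda>f. (f, b f)) ` \<Phi> \<subseteq> N" "coherent_on unit_cube N"
    and total: "\<And>g B. (\<And>x. x \<in> unit_cube \<Longrightarrow> \<bar>g x\<bar> \<le> B) \<Longrightarrow> \<exists>t. (g, t) \<in> N"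
    using coherent_on_extend[OF coh] zero_in_unit_cube by (metis empty_iff)
  \<comment> \<open>The choice is harmless: by \<open>eq\<close> below, coherence leaves only one
    price per function.\<close>
  define s where "s f = (SOME t. (f, t) \<in> N)" for f
  have memN: "(f, s f) \<in> affine_pairs N" if "f \<in> mcnaughton" for f
  proof -
    have "\<exists>t. (f, t) \<in> N"
      by (rule total[of f 1]) (use mcnaughton_range[OF that] in simp)
    from someI_ex[OF this] show ?thesis
      unfolding s_def by (rule affine_pairs_base)
  qed
  have eq: "r = q" if "(w, r) \<in> affine_pairs N" "(v, q) \<in> affine_pairs N"
    "\<And>x. x \<in> unit_cube \<Longrightarrow> w x = v x" for w r v q
    using coherent_on_mono[OF N(2) that(1,2)] coherent_on_mono[OF N(2) that(2,1)] that(3) by force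
  have "mv_state free_mv s"
    unfolding mv_state_def mv_carrier_free_mv
  proof (intro conjI ballI impI funcsetI)
    fix f :: "real^'n \<Rightarrow> real" assume f: "f \<in> mcnaughton"
    have "0 \<le> s f" "s f \<le> 1"
      using coherent_on_mono[OF N(2) affine_pairs.const memN[OF f], of 0]
        coherent_on_mono[OF N(2) memN[OF f] affine_pairs.const, of 1] mcnaughton_range[OF f]
      by auto
    then show "s f \<in> {0..1}"
      by simp
  next
    show "s (mv_one free_mv) = 1"
      unfolding free_mv_one by (rule eq[OF memN[OF mcnaughton_one] affine_pairs.const]) simp
  next
    fix f g :: "real^'n \<Rightarrow> real"
    assume f: "f \<in> mcnaughton" and g: "g \<in> mcnaughton"
      and orth: "mv_odot free_mv f g = mv_zero free_mv"
    have "s (mv_oplus free_mv f g) = s f + 1 * s g"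
    proof (rule eq[OF memN affine_pairs_lincomb[OF memN[OF f] memN[OF g]]])
      show "mv_oplus free_mv f g \<in> mcnaughton"
        unfolding mv_oplus_free_mv using f g by (rule mcnaughton_oplus)
    qed (use orth in \<open>simp add: free_mv_odot_eq_zero_iff mv_oplus_free_mv\<close>)
    then show "s (mv_oplus free_mv f g) = s f + s g"
      by simp
  qed
  moreover have "s f = b f" if "f \<in> \<Phi>" for f
  proof -
    have b: "(f, b f) \<in> N"
      using N(1) that by blast
    then have "(f, s f) \<in> N"
      unfolding s_def by (rule someI[of "\<lambda>t. (f, t) \<in> N"])
    from eq[OF affine_pairs_base[OF this] affine_pairs_base[OF b]] show ?thesis
      by simp
  qed
  ultimately show ?thesis
    by blast
qed

lemma faithful_of_strictly_coherent:
  fixes \<Phi> :: "(real^'n \<Rightarrow> real) set"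
  assumes fin: "finite \<Phi>" and mc: "\<Phi> \<subseteq> mcnaughton" and \<beta>: "\<beta> \<in> \<Phi> \<rightarrow> {0..1}"
    and sc: "strictly_coherent \<Phi> \<beta>"
  obtains s where "faithful_mv_state free_mv s" "\<And>f. f \<in> \<Phi> \<Longrightarrow> s f = \<beta> f"
proof -
  let ?I = "integral unit_cube :: (real^'n \<Rightarrow> real) \<Rightarrow> real"
  \<comment> \<open>The functions are centred at their prices, so that \<open>c\<close> is the price
    of the whole combination.\<close>
  have "\<exists>\<theta>>0. \<forall>\<sigma> c. (\<forall>x\<in>unit_cube. 0 \<le> c + (\<Sum>f\<in>\<Phi>. \<sigma> f * (f x - \<beta> f))) \<longrightarrow>
           (\<forall>y\<in>unit_cube. \<theta> * (\<Sum>f\<in>\<Phi>. \<sigma> f * (f y - \<beta> f)) \<le> c)"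
  proof (rule strict_uniform_bound[OF fin, of unit_cube "\<lambda>f x. f x - \<beta> f"])
    fix f and x :: "real^'n" assume f: "f \<in> \<Phi>" and x: "x \<in> unit_cube"
    have "0 \<le> f x \<and> f x \<le> 1"
      using mc f x by (intro mcnaughton_range) auto
    moreover have "\<beta> f \<in> {0..1}"
      using \<beta> f by (rule funcset_mem)
    ultimately show "\<bar>f x - \<beta> f\<bar> \<le> 1"
      by (simp add: abs_le_iff)
  next
    fix \<sigma> :: "(real^'n \<Rightarrow> real) \<Rightarrow> real"
    have neg: "(\<Sum>f\<in>\<Phi>. \<sigma> f * (\<beta> f - f x)) = - (\<Sum>f\<in>\<Phi>. \<sigma> f * (f x - \<beta> f))" for x
      by (simp flip: sum_negf add: algebra_simps)
    assume "\<exists>x\<in>unit_cube. 0 < (\<Sum>f\<in>\<Phi>. \<sigma> f * (f x - \<beta> f))"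
    then show "\<exists>x\<in>unit_cube. (\<Sum>f\<in>\<Phi>. \<sigma> f * (f x - \<beta> f)) < 0"
      using sc[unfolded strictly_coherent_def, rule_format, of \<sigma>] by (simp add: neg)
  qed
  then obtain \<kappa> where \<kappa>: "\<kappa> > 0" and bound:
    "\<And>\<sigma> c y. \<forall>x\<in>unit_cube. 0 \<le> c + (\<Sum>f\<in>\<Phi>. \<sigma> f * (f x - \<beta> f)) \<Longrightarrow> y \<in> unit_cube \<Longrightarrow>
       \<kappa> * (\<Sum>f\<in>\<Phi>. \<sigma> f * (f y - \<beta> f)) \<le> c"
    by blast
  \<comment> \<open>This turns \<kappa>(w y - L) \<le> L into \<theta> w y \<le> L and keeps the
    weight below 1.\<close>
  define \<theta> where "\<theta> = \<kappa> / (1 + \<kappa>)"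
  have \<theta>: "0 < \<theta>" "\<theta> < 1"
    using \<kappa> by (auto simp: \<theta>_def)
  \<comment> \<open>\<open>b\<close> solves \<theta> \<open>?I f\<close> + (1 - \<theta>)
    \<open>b f\<close> = \<open>\<beta> f\<close>, so that mixing the integral back in restores the
    book.\<close>
  define b where "b f = (\<beta> f - \<theta> * ?I f) / (1 - \<theta>)" for f
  have "coherent_on unit_cube ((\<lambda>f. (f, b f)) ` \<Phi>)"
    unfolding coherent_on_def
  proof clarify
    fix w r assume "(w, r) \<in> affine_pairs ((\<lambda>f. (f, b f)) ` \<Phi>)" and pos: "\<forall>x\<in>unit_cube. 0 \<le> w x"
    then obtain \<sigma> c where w: "w = (\<lambda>x. c + (\<Sum>f\<in>\<Phi>. \<sigma> f * f x))" and r: "r = c + (\<Sum>f\<in>\<Phi>. \<sigma> f * b f)"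
      using affine_pairs_graph fin by blast
    define L where "L = c + (\<Sum>f\<in>\<Phi>. \<sigma> f * \<beta> f)"
    have w_eq: "w x = L + (\<Sum>f\<in>\<Phi>. \<sigma> f * (f x - \<beta> f))" for x
      by (simp add: w L_def right_diff_distrib sum_subtractf)
    have "w y \<le> L / \<theta>" if "y \<in> unit_cube" for y
    proof -
      have "\<kappa> * (w y - L) \<le> L"
        using bound[of L \<sigma> y] pos that by (simp add: w_eq)
      then show ?thesis
        using \<kappa> by (simp add: \<theta>_def field_simps)
    qed
    moreover have "continuous_on unit_cube w"
      using mc unfolding w by (intro continuous_intros) (auto intro: mcnaughton_continuous)
    \<comment> \<open>The cube has measure 1, so the pointwise bound on \<open>w\<close> passes to
      its integral.\<close>
    ultimately have "?I w \<le> ?I (\<lambda>x. L / \<theta>)"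
      by (intro integral_le integrable_unit_cube continuous_on_const)
    then have le: "\<theta> * ?I w \<le> L"
      using \<theta> by (simp add: integral_unit_cube_const field_simps)
    have "(1 - \<theta>) * (\<Sum>f\<in>\<Phi>. \<sigma> f * b f) = (\<Sum>f\<in>\<Phi>. \<sigma> f * \<beta> f) - \<theta> * (\<Sum>f\<in>\<Phi>. \<sigma> f * ?I f)"
      unfolding sum_distrib_left sum_subtractf[symmetric]
      by (rule sum.cong) (use \<theta> in \<open>auto simp: b_def field_simps\<close>)
    then have "(1 - \<theta>) * r = L - \<theta> * ?I w"
      using integral_unit_cube_combination[OF fin mc, of c \<sigma>]
      by (simp add: r w L_def algebra_simps)
    with le \<theta> show "0 \<le> r"
      by (metis diff_ge_0_iff_ge diff_gt_0_iff_gt zero_le_mult_iff not_less)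
  qed
  then obtain s where s: "mv_state free_mv s" "\<And>f. f \<in> \<Phi> \<Longrightarrow> s f = b f"
    using coherent_extends_to_state by blast
  define t where "t f = \<theta> * ?I f + (1 - \<theta>) * s f" for f
  have pos: "0 < t f" if "f \<in> mcnaughton" "f \<noteq> (\<lambda>x\<in>unit_cube. 0)" for f
    using integral_mcnaughton_pos[OF that] mv_state_range[OF s(1) that(1)] \<theta>
    by (simp add: t_def add_pos_nonneg)
  have "mv_state free_mv t"
    unfolding mv_state_def mv_carrier_free_mv
  proof (intro conjI ballI impI funcsetI)
    fix f :: "real^'n \<Rightarrow> real" assume f: "f \<in> mcnaughton"
    note bds = integral_mcnaughton_nonneg[OF f] integral_mcnaughton_le_one[OF f] mv_state_range[OF s(1) f]
    have "0 \<le> t f"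
      using bds \<theta> by (simp add: t_def)
    moreover have "t f \<le> \<theta> * 1 + (1 - \<theta>) * 1"
      unfolding t_def using bds \<theta> by (intro add_mono mult_left_mono) auto
    ultimately show "t f \<in> {0..1}"
      by simp
  next
    have "?I (\<lambda>x\<in>unit_cube. 1) = 1"
      using integral_unit_cube_const[of 1, where 'n = 'n] integral_cong[of "unit_cube :: (real^'n) set" "\<lambda>x\<in>unit_cube. 1" "\<lambda>x. 1 :: real"]
      by simp
    moreover have "s (\<lambda>x\<in>unit_cube. 1) = 1"
      using s(1) by (simp add: mv_state_def free_mv_one)
    ultimately show "t (mv_one free_mv) = 1"
      by (simp add: t_def free_mv_one)
  next
    fix f g :: "real^'n \<Rightarrow> real"
    assume f: "f \<in> mcnaughton" and g: "g \<in> mcnaughton"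
      and orth: "mv_odot free_mv f g = mv_zero free_mv"
    have "?I (mv_oplus free_mv f g) = ?I (\<lambda>x. f x + g x)"
      using orth by (intro integral_cong) (simp add: free_mv_odot_eq_zero_iff mv_oplus_free_mv)
    also have "\<dots> = ?I f + ?I g"
      using f g by (intro integral_add integrable_unit_cube mcnaughton_continuous)
    finally show "t (mv_oplus free_mv f g) = t f + t g"
      using s(1) f g orth by (simp add: t_def mv_state_def algebra_simps)
  qed
  then have "faithful_mv_state free_mv t"
    using pos by (force simp: faithful_mv_state_def mv_zero_free_mv)
  moreover have "t f = \<beta> f" if "f \<in> \<Phi>" for f
    using \<theta> that by (simp add: t_def s(2) b_def)
  ultimately show thesis
    by (rule that)
qed

theorem theorem4p8:
  fixes \<Phi> :: "(real^'n \<Rightarrow> real) set"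
    and \<beta> :: "(real^'n \<Rightarrow> real) \<Rightarrow> real"
  assumes "finite \<Phi>"
    and "\<Phi> \<subseteq> mv_carrier free_mv"
    and "\<beta> \<in> \<Phi> \<rightarrow> {0..1}"
  shows "strictly_coherent \<Phi> \<beta> \<longleftrightarrow>
         (\<exists>s. faithful_mv_state free_mv s \<and> (\<forall>f\<in>\<Phi>. s f = \<beta> f))"
proof
  have mc: "\<Phi> \<subseteq> mcnaughton"
    using assms(2) by simp
  show "\<exists>s. faithful_mv_state free_mv s \<and> (\<forall>f\<in>\<Phi>. s f = \<beta> f)" if "strictly_coherent \<Phi> \<beta>"
    using faithful_of_strictly_coherent[OF assms(1) mc assms(3) that] by metis
  show "strictly_coherent \<Phi> \<beta>" if "\<exists>s. faithful_mv_state free_mv s \<and> (\<forall>f\<in>\<Phi>. s f = \<beta> f)"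
    using strictly_coherent_of_faithful[OF assms(1) mc] that by metis
qed

end
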